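(* The conjugacy problem in the group $B_2(\Sigma_{1,0})$ is solvable.
   Context: $B_2(\Sigma_{1,0})$ is the braid group on two strands of the torus $\Sigma_{1,0}$, i.e. the fundamental group of the configuration space of 2 unordered distinct points of the torus. It has the finite presentation $$B_2(\Sigma_{1,0})=\langle a,b,c\mid a^2b=ba^2;\ b^2a=ab^2;\ a^2c=ca^2;\ b^2c=cb^2;\ a^2b^2=c^2\rangle .$$ Solvability of the conjugacy problem means that there is an algorithm which, given two words in $a^{\pm1},b^{\pm1},c^{\pm1}$, decides whether they represent conjugate elements of the group. *)

theory Defs
  imports "HOL-Library.Nat_Bijection" "HOL-Algebra.Group"
begin

section \<open>Algorithms: partial recursive functions\<close>

datatype recf =
    Zero
  | Succ
  | Proj nat
  | Comp recf "recf list"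
  | PrimRec recf recf
  | Mu recf

text \<open>
  \<open>computes f xs y\<close>: the computation of \<open>f\<close> on the argument tuple \<open>xs\<close> halts with result \<open>y\<close>.
  Arities are not tracked: a program applied to a tuple of the wrong length either halts (when no
  rule inspects the surplus arguments) or has no result.
\<close>

inductive computes :: "recf \<Rightarrow> nat list \<Rightarrow> nat \<Rightarrow> bool" where
  zero: "computes Zero xs 0"
| succ: "computes Succ [x] (Suc x)"
| proj: "i < length xs \<Longrightarrow> computes (Proj i) xs (xs ! i)"
| comp: "list_all2 (\<lambda>g y. computes g xs y) gs ys \<Longrightarrow> computes f ys z
          \<Longrightarrow> computes (Comp f gs) xs z"
| prim_rec_0: "computes f xs y \<Longrightarrow> computes (PrimRec f g) (0 # xs) y"
| prim_rec_Suc: "computes (PrimRec f g) (k # xs) y \<Longrightarrow> computes g (k # y # xs) z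
          \<Longrightarrow> computes (PrimRec f g) (Suc k # xs) z"
| mu: "computes f (k # xs) 0 \<Longrightarrow> (\<And>j. j < k \<Longrightarrow> \<exists>y. computes f (j # xs) (Suc y))
          \<Longrightarrow> computes (Mu f) xs k"

inductive_cases computes_ZeroE: "computes Zero xs y"
inductive_cases computes_SuccE: "computes Succ xs y"
inductive_cases computes_ProjE: "computes (Proj i) xs y"
inductive_cases computes_CompE: "computes (Comp f gs) xs y"
inductive_cases computes_PrimRec0E: "computes (PrimRec f g) (0 # xs) y"
inductive_cases computes_PrimRecSucE: "computes (PrimRec f g) (Suc k # xs) y"
inductive_cases computes_MuE: "computes (Mu f) xs y"

lemma computes_deterministic: "computes f xs y \<Longrightarrow> computes f xs z \<Longrightarrow> y = z"
proof (induction arbitrary: z rule: computes.induct)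
  case (zero xs)
  from zero.prems show ?case by (rule computes_ZeroE) simp
next
  case (succ x)
  from succ.prems show ?case by (rule computes_SuccE) simp
next
  case (proj i xs)
  from proj.prems show ?case by (rule computes_ProjE) simp
next
  case (comp xs gs ys f z z')
  from comp.prems obtain ys' where ys': "list_all2 (\<lambda>g y. computes g xs y) gs ys'"
    and f: "computes f ys' z'"
    by (rule computes_CompE) (rule that)
  have "ys = ys'"
  proof (rule nth_equalityI)
    show len: "length ys = length ys'"
      using list_all2_lengthD[OF comp.IH(1)] list_all2_lengthD[OF ys'] by simp
    show "ys ! i = ys' ! i" if "i < length ys" for i
    proof -
      have "i < length gs" using that list_all2_lengthD[OF comp.IH(1)] by simp
      with list_all2_nthD[OF comp.IH(1)] list_all2_nthD[OF ys'] show ?thesis by blast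
    qed
  qed
  with f have "computes f ys z'" by simp
  then show ?case by (rule comp.IH(2))
next
  case (prim_rec_0 f xs y g)
  from prim_rec_0.prems show ?case
    by (rule computes_PrimRec0E) (rule prim_rec_0.IH)
next
  case (prim_rec_Suc f g k xs y z z')
  from prim_rec_Suc.prems obtain y' where "computes (PrimRec f g) (k # xs) y'"
      "computes g (k # y' # xs) z'"
    by (rule computes_PrimRecSucE)
  then show ?case using prim_rec_Suc.IH by metis
next
  case (mu f k xs)
  from mu.prems obtain z: "computes f (z # xs) 0"
    and less: "\<And>j. j < z \<Longrightarrow> \<exists>y. computes f (j # xs) (Suc y)"
    by (rule computes_MuE) blast
  show ?case
  proof (rule linorder_cases[of k z])
    assume "k < z"
    with less obtain y where "computes f (k # xs) (Suc y)" by blast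
    then show ?thesis using mu.IH(1) by force
  next
    assume "z < k"
    with mu.IH(2) obtain y where "\<And>x. computes f (z # xs) x \<Longrightarrow> Suc y = x" by metis
    from this[OF z] show ?thesis by simp
  qed
qed


section \<open>Words and conjugacy\<close>

text \<open>The letter \<open>(i, True)\<close> stands for the \<open>i\<close>-th generator, \<open>(i, False)\<close> for its inverse.\<close>

type_synonym word = "(nat \<times> bool) list"

definition words :: "nat \<Rightarrow> word set" where
  "words n = lists ({..<n} \<times> UNIV)"

definition word_val :: "('a, 'b) monoid_scheme \<Rightarrow> 'a list \<Rightarrow> word \<Rightarrow> 'a" where
  "word_val G gs w =
     foldr (\<lambda>(i, s) x. (if s then gs ! i else inv\<^bsub>G\<^esub> (gs ! i)) \<otimes>\<^bsub>G\<^esub> x) w \<one>\<^bsub>G\<^esub>"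

definition word_code :: "word \<Rightarrow> nat" where
  "word_code w = list_encode (map (\<lambda>(i, s). prod_encode (i, of_bool s)) w)"

definition conjugate_in :: "('a, 'b) monoid_scheme \<Rightarrow> 'a \<Rightarrow> 'a \<Rightarrow> bool" where
  "conjugate_in G x y \<longleftrightarrow> (\<exists>g \<in> carrier G. y = g \<otimes>\<^bsub>G\<^esub> x \<otimes>\<^bsub>G\<^esub> inv\<^bsub>G\<^esub> g)"

text \<open>
  Here \<open>gs\<close> is a finite list of generators of \<open>G\<close>. The algorithm has to halt on every pair of words
  in the generators and their inverses, with answer 1 or 0.
\<close>

definition conjugacy_problem_solvable :: "('a, 'b) monoid_scheme \<Rightarrow> 'a list \<Rightarrow> bool" where
  "conjugacy_problem_solvable G gs \<longleftrightarrow>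
     (\<exists>f. \<forall>u \<in> words (length gs). \<forall>v \<in> words (length gs).
        computes f [word_code u, word_code v]
          (if conjugate_in G (word_val G gs u) (word_val G gs v) then 1 else 0))"


section \<open>Groups given by generators and relations\<close>

text \<open>A pair \<open>(l, r)\<close> in \<open>R\<close> stands for the defining relation \<open>l = r\<close>.\<close>

inductive word_eq :: "nat \<Rightarrow> (word \<times> word) set \<Rightarrow> word \<Rightarrow> word \<Rightarrow> bool"
  for n :: nat and R :: "(word \<times> word) set" where
  refl: "w \<in> words n \<Longrightarrow> word_eq n R w w"
| sym: "word_eq n R u v \<Longrightarrow> word_eq n R v u"
| trans: "word_eq n R u v \<Longrightarrow> word_eq n R v w \<Longrightarrow> word_eq n R u w"
| cancel: "u \<in> words n \<Longrightarrow> v \<in> words n \<Longrightarrow> i < n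
            \<Longrightarrow> word_eq n R (u @ [(i, s), (i, \<not> s)] @ v) (u @ v)"
| relation: "u \<in> words n \<Longrightarrow> v \<in> words n \<Longrightarrow> (l, r) \<in> R \<Longrightarrow> l \<in> words n \<Longrightarrow> r \<in> words n
            \<Longrightarrow> word_eq n R (u @ l @ v) (u @ r @ v)"

definition word_class :: "nat \<Rightarrow> (word \<times> word) set \<Rightarrow> word \<Rightarrow> word set" where
  "word_class n R w = {v. word_eq n R w v}"

definition presented_group :: "nat \<Rightarrow> (word \<times> word) set \<Rightarrow> word set monoid" where
  "presented_group n R =
     \<lparr>carrier = word_class n R ` words n,
      mult = (\<lambda>X Y. \<Union>u\<in>X. \<Union>v\<in>Y. word_class n R (u @ v)),
      one = word_class n R []\<rparr>"

definition presentation_gens :: "nat \<Rightarrow> (word \<times> word) set \<Rightarrow> word set list" where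
  "presentation_gens n R = map (\<lambda>i. word_class n R [(i, True)]) [0..<n]"

lemma words_simps [simp]:
  "[] \<in> words n"
  "x # w \<in> words n \<longleftrightarrow> fst x < n \<and> w \<in> words n"
  "u @ v \<in> words n \<longleftrightarrow> u \<in> words n \<and> v \<in> words n"
  by (auto simp: words_def mem_Times_iff)

lemma word_eq_words: "word_eq n R u v \<Longrightarrow> u \<in> words n \<and> v \<in> words n"
  by (induction rule: word_eq.induct) auto

lemma word_eq_append:
  assumes "word_eq n R u u'" "word_eq n R v v'"
  shows "word_eq n R (u @ v) (u' @ v')"
proof -
  have *: "word_eq n R (p @ u @ q) (p @ u' @ q)"
    if "word_eq n R u u'" "p \<in> words n" "q \<in> words n" for p q u u'
    using that
  proof (induction rule: word_eq.induct)
    case (refl w)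
    then show ?case by (auto intro: word_eq.refl)
  next
    case (sym u v)
    then show ?case by (metis word_eq.sym)
  next
    case (trans u v w)
    then show ?case by (metis word_eq.trans)
  next
    case (cancel u v i s)
    then show ?case using word_eq.cancel[of "p @ u" n "v @ q" i R s] by simp
  next
    case (relation u v l r)
    then show ?case using word_eq.relation[of "p @ u" n "v @ q" l r R] by simp
  qed
  have "word_eq n R (u @ v) (u' @ v)"
    using *[of u u' "[]" v] assms word_eq_words[OF assms(2)] by simp
  moreover have "word_eq n R (u' @ v) (u' @ v')"
    using *[of v v' u' "[]"] assms word_eq_words[OF assms(1)] by simp
  ultimately show ?thesis by (rule word_eq.trans)
qed

lemma word_class_eq_iff:
  "u \<in> words n \<Longrightarrow> word_class n R u = word_class n R v \<longleftrightarrow> word_eq n R u v"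
  unfolding word_class_def set_eq_iff mem_Collect_eq
  by (metis word_eq.refl word_eq.sym word_eq.trans)

lemma presented_group_mult:
  assumes "u \<in> words n" "v \<in> words n"
  shows "word_class n R u \<otimes>\<^bsub>presented_group n R\<^esub> word_class n R v = word_class n R (u @ v)"
proof -
  have cls: "word_class n R (u' @ v') = word_class n R (u @ v)"
    if "u' \<in> word_class n R u" "v' \<in> word_class n R v" for u' v'
  proof -
    have "word_eq n R (u @ v) (u' @ v')"
      using that by (auto simp: word_class_def intro: word_eq_append)
    moreover have "u @ v \<in> words n" using assms by simp
    ultimately show ?thesis using word_class_eq_iff by metis
  qed
  have "(\<Union>u'\<in>word_class n R u. \<Union>v'\<in>word_class n R v. word_class n R (u' @ v'))
      = (\<Union>u'\<in>word_class n R u. \<Union>v'\<in>word_class n R v. word_class n R (u @ v))"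
    by (intro SUP_cong HOL.refl cls)
  moreover have "u \<in> word_class n R u" "v \<in> word_class n R v"
    using assms by (auto simp: word_class_def intro: word_eq.refl)
  then have "(\<Union>u'\<in>word_class n R u. \<Union>v'\<in>word_class n R v. word_class n R (u @ v))
      = word_class n R (u @ v)"
    by blast
  ultimately show ?thesis by (simp add: presented_group_def)
qed

lemma word_eq_inverse:
  "w \<in> words n \<Longrightarrow> word_eq n R (rev (map (\<lambda>(i, s). (i, \<not> s)) w) @ w) []"
proof (induction w)
  case Nil
  then show ?case by (simp add: word_eq.refl)
next
  case (Cons x w)
  obtain i s where x: "x = (i, s)" by force
  let ?W = "rev (map (\<lambda>(i, s). (i, \<not> s)) w)"
  have "?W \<in> words n" using Cons.prems by (auto simp: words_def)
  then have "word_eq n R (?W @ [(i, \<not> s), (i, s)] @ w) (?W @ w)"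
    using Cons.prems word_eq.cancel[of ?W n w i R "\<not> s"] x by simp
  moreover have "word_eq n R (?W @ w) []" using Cons by simp
  ultimately have "word_eq n R (?W @ [(i, \<not> s), (i, s)] @ w) []"
    by (rule word_eq.trans)
  then show ?case using x by simp
qed

lemma group_presented_group: "group (presented_group n R)"
proof (rule groupI)
  fix x assume "x \<in> carrier (presented_group n R)"
  then obtain u where u: "u \<in> words n" "x = word_class n R u"
    by (auto simp: presented_group_def)
  let ?u' = "rev (map (\<lambda>(i, s). (i, \<not> s)) u)"
  have u': "?u' \<in> words n" using u by (auto simp: words_def)
  have "word_class n R ?u' \<otimes>\<^bsub>presented_group n R\<^esub> x = word_class n R []"
    using u u' word_eq_inverse[of u n R] by (simp add: presented_group_mult word_class_eq_iff)
  with u' show "\<exists>y\<in>carrier (presented_group n R).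
      y \<otimes>\<^bsub>presented_group n R\<^esub> x = \<one>\<^bsub>presented_group n R\<^esub>"
    by (auto simp: presented_group_def)
  show "\<one>\<^bsub>presented_group n R\<^esub> \<otimes>\<^bsub>presented_group n R\<^esub> x = x"
    using u presented_group_mult[of "[]" n u R] by (simp add: presented_group_def)
next
  fix x y assume "x \<in> carrier (presented_group n R)" "y \<in> carrier (presented_group n R)"
  then obtain u v where uv: "u \<in> words n" "x = word_class n R u" "v \<in> words n" "y = word_class n R v"
    by (auto simp: presented_group_def)
  then have "x \<otimes>\<^bsub>presented_group n R\<^esub> y = word_class n R (u @ v)"
    by (simp add: presented_group_mult)
  with uv show "x \<otimes>\<^bsub>presented_group n R\<^esub> y \<in> carrier (presented_group n R)"
    by (auto simp: presented_group_def)
  fix z assume "z \<in> carrier (presented_group n R)"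
  then obtain w where w: "w \<in> words n" "z = word_class n R w"
    by (auto simp: presented_group_def)
  show "x \<otimes>\<^bsub>presented_group n R\<^esub> y \<otimes>\<^bsub>presented_group n R\<^esub> z =
        x \<otimes>\<^bsub>presented_group n R\<^esub> (y \<otimes>\<^bsub>presented_group n R\<^esub> z)"
    using uv w by (simp add: presented_group_mult)
qed (auto simp: presented_group_def)

lemma word_val_presented_group:
  assumes "w \<in> words n"
  shows "word_val (presented_group n R) (presentation_gens n R) w = word_class n R w"
  using assms
proof (induction w)
  case Nil
  then show ?case by (simp add: word_val_def presented_group_def)
next
  case (Cons x w)
  interpret group "presented_group n R" by (rule group_presented_group)
  obtain i s where x: "x = (i, s)" by force
  with Cons have i: "i < n" and w: "w \<in> words n" by auto
  have cls: "word_class n R [(i, t)] \<in> carrier (presented_group n R)" for t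
    using i by (auto simp: presented_group_def)
  have "word_eq n R [(i, False), (i, True)] []"
    using word_eq.cancel[of "[]" n "[]" i R False] i by simp
  then have "word_class n R [(i, False)] \<otimes>\<^bsub>presented_group n R\<^esub> word_class n R [(i, True)]
      = \<one>\<^bsub>presented_group n R\<^esub>"
    using i by (simp add: presented_group_mult word_class_eq_iff)
       (simp add: presented_group_def word_class_eq_iff)
  then have "inv\<^bsub>presented_group n R\<^esub> (word_class n R [(i, True)]) = word_class n R [(i, False)]"
    using cls by (intro inv_equality)
  then have letter: "(if s then presentation_gens n R ! i
        else inv\<^bsub>presented_group n R\<^esub> (presentation_gens n R ! i)) = word_class n R [(i, s)]"
    using i by (simp add: presentation_gens_def)
  have "word_val (presented_group n R) (presentation_gens n R) (x # w) =
      word_class n R [(i, s)] \<otimes>\<^bsub>presented_group n R\<^esub> word_class n R w"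
    using Cons.IH[OF w] letter x by (simp add: word_val_def)
  then show ?case using i w x by (simp add: presented_group_mult)
qed


section \<open>The braid group on two strands of the torus\<close>

text \<open>
  The fundamental group of the space of unordered pairs of distinct points of the torus, given by
  its presentation with generators \<open>a\<close>, \<open>b\<close>, \<open>c\<close> and relations
  \<open>a\<^sup>2 b = b a\<^sup>2\<close>, \<open>b\<^sup>2 a = a b\<^sup>2\<close>, \<open>a\<^sup>2 c = c a\<^sup>2\<close>, \<open>b\<^sup>2 c = c b\<^sup>2\<close>, \<open>a\<^sup>2 b\<^sup>2 = c\<^sup>2\<close>.
\<close>

definition B2_torus_relations :: "(word \<times> word) set" where
  "B2_torus_relations =
     (let a = (0, True); b = (1, True); c = (2, True) in
       {([a, a, b], [b, a, a]),
        ([b, b, a], [a, b, b]),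
        ([a, a, c], [c, a, a]),
        ([b, b, c], [c, b, b]),
        ([a, a, b, b], [c, c])})"

definition B2_torus :: "word set monoid" where
  "B2_torus = presented_group 3 B2_torus_relations"

definition B2_torus_gens :: "word set list" where
  "B2_torus_gens = presentation_gens 3 B2_torus_relations"

end

theory Submission
  imports Defs
begin

text \<open>
  The central subgroup generated by \<open>a\<^sup>2\<close> and \<open>b\<^sup>2\<close> has quotient \<open>C\<^sub>2 * C\<^sub>2 * C\<^sub>2\<close>, and the
  two homomorphisms to the integers \<open>a, b, c \<mapsto> 1, 0, 1\<close> and \<open>a, b, c \<mapsto> 0, 1, 1\<close> jointly separate
  its elements. So the group embeds in \<open>\<int>\<^sup>2 \<times> (C\<^sub>2 * C\<^sub>2 * C\<^sub>2)\<close>, and two elements are conjugate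
  iff they have the same image in \<open>\<int>\<^sup>2\<close> and conjugate images in the free product. Conjugating a
  reduced word \<open>w\<close> by its first letter rotates it and cancels at the seam if possible; two reduced
  words are conjugate iff their orbits under this map meet. Each orbit stays in a finite set of
  words, so the test takes a bounded number of steps and is primitive recursive.
\<close>

section \<open>Computable functions\<close>

text \<open>\<open>computes\<close> does not track arities, so the arity \<open>k\<close> is fixed
  here: the program must halt on every tuple of length \<open>k\<close>, and its behaviour on other
  tuples is left open.\<close>

definition computable :: "nat \<Rightarrow> (nat list \<Rightarrow> nat) \<Rightarrow> bool" where
  "computable k F \<longleftrightarrow> (\<exists>p. \<forall>xs. length xs = k \<longrightarrow> computes p xs (F xs))"

abbreviation computable1 :: "(nat \<Rightarrow> nat) \<Rightarrow> bool" where
  "computable1 f \<equiv> computable 1 (\<lambda>xs. f (xs ! 0))"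

abbreviation computable2 :: "(nat \<Rightarrow> nat \<Rightarrow> nat) \<Rightarrow> bool" where
  "computable2 f \<equiv> computable 2 (\<lambda>xs. f (xs ! 0) (xs ! 1))"

lemma computable_cong:
  assumes "computable k F" "\<And>xs. length xs = k \<Longrightarrow> F xs = G xs"
  shows "computable k G"
  using assms unfolding computable_def by metis

lemma computable_compose:
  assumes F: "computable (length Gs) F" and Gs: "\<And>G. G \<in> set Gs \<Longrightarrow> computable k G"
  shows "computable k (\<lambda>xs. F (map (\<lambda>G. G xs) Gs))"
proof -
  obtain p where p: "\<And>xs. length xs = length Gs \<Longrightarrow> computes p xs (F xs)"
    using F unfolding computable_def by blast
  obtain q where q: "\<And>G xs. G \<in> set Gs \<Longrightarrow> length xs = k \<Longrightarrow> computes (q G) xs (G xs)"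
    using Gs unfolding computable_def by metis
  have "computes (Comp p (map q Gs)) xs (F (map (\<lambda>G. G xs) Gs))" if "length xs = k" for xs
  proof (rule computes.comp)
    show "list_all2 (\<lambda>g. computes g xs) (map q Gs) (map (\<lambda>G. G xs) Gs)"
      using q that by (simp add: list_all2_conv_all_nth)
  qed (simp add: p)
  then show ?thesis unfolding computable_def by blast
qed

lemma computable_apply1:
  assumes "computable1 f" "computable k g"
  shows "computable k (\<lambda>xs. f (g xs))"
  using computable_compose[of "[g]" "\<lambda>xs. f (xs ! 0)" k] assms by simp

lemma computable_apply2:
  assumes "computable2 f" "computable k g" "computable k h"
  shows "computable k (\<lambda>xs. f (g xs) (h xs))"
  using computable_compose[of "[g, h]" "\<lambda>xs. f (xs ! 0) (xs ! 1)" k] assms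
  by (auto simp: numeral_2_eq_2)

lemma computable_nth: "i < k \<Longrightarrow> computable k (\<lambda>xs. xs ! i)"
  unfolding computable_def by (metis computes.proj)

text \<open>Bounded sums and quantifiers put their bound variable in front of the tuple. Below one
  or two such binders the outer variables are read through one or two applications of
  \<open>tl\<close>.\<close>

lemma computable_nth_tl:
  "Suc i < k \<Longrightarrow> computable k (\<lambda>xs. tl xs ! i)"
  "Suc (Suc i) < k \<Longrightarrow> computable k (\<lambda>xs. tl (tl xs) ! i)"
  by (rule computable_cong[OF computable_nth[of "Suc i"]], simp_all add: nth_tl)
     (rule computable_cong[OF computable_nth[of "Suc (Suc i)"]], simp_all add: nth_tl)

lemma computable_Suc:
  assumes "computable k f"
  shows "computable k (\<lambda>xs. Suc (f xs))"
proof -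
  have "computes Succ xs (Suc (xs ! 0))" if "length xs = 1" for xs
    using that computes.succ by (cases xs) auto
  then have "computable1 Suc" unfolding computable_def by blast
  then show ?thesis using assms by (rule computable_apply1)
qed

lemma computable_const: "computable k (\<lambda>xs. c)"
proof (induction c)
  case 0
  then show ?case unfolding computable_def by (metis computes.zero)
next
  case (Suc c)
  then show ?case by (rule computable_Suc)
qed

text \<open>In the step of a recursion the parameters follow the counter and the previous value;
  with \<open>m = 2\<close> a function of the parameters becomes usable there.\<close>

lemma computable_drop:
  assumes "computable k f"
  shows "computable (m + k) (\<lambda>xs. f (drop m xs))"
proof -
  let ?Gs = "map (\<lambda>i xs. xs ! (m + i)) [0..<k]"
  have "computable (m + k) (\<lambda>xs. f (map (\<lambda>G. G xs) ?Gs))"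
    using assms by (intro computable_compose) (auto intro: computable_nth)
  then show ?thesis
    by (rule computable_cong) (auto intro!: arg_cong[of _ _ f] nth_equalityI)
qed

lemma computable_rec_nat:
  assumes n: "computable k n" and b: "computable k b"
    and s: "computable (2 + k) (\<lambda>ys. s (ys ! 0) (ys ! 1) (drop 2 ys))"
  shows "computable k (\<lambda>xs. rec_nat (b xs) (\<lambda>i y. s i y xs) (n xs))"
proof -
  let ?F = "\<lambda>m xs. rec_nat (b xs) (\<lambda>i y. s i y xs) m"
  obtain p where p: "\<And>xs. length xs = k \<Longrightarrow> computes p xs (b xs)"
    using b unfolding computable_def by blast
  obtain q where q: "\<And>xs. length xs = 2 + k \<Longrightarrow> computes q xs (s (xs ! 0) (xs ! 1) (drop 2 xs))"
    using s unfolding computable_def by blast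
  have q': "computes q (i # y # xs) (s i y xs)" if "length xs = k" for i y xs
    using q[of "i # y # xs"] that by (simp add: numeral_2_eq_2)
  have *: "computes (PrimRec p q) (m # xs) (?F m xs)" if "length xs = k" for m xs
    by (induction m) (use that p q' in \<open>auto intro: computes.intros\<close>)
  have "computes (PrimRec p q) ys (?F (hd ys) (tl ys))" if "length ys = Suc k" for ys
    using that *[of "tl ys" "hd ys"] by (cases ys) auto
  then have F: "computable (Suc k) (\<lambda>ys. ?F (hd ys) (tl ys))"
    unfolding computable_def by blast
  \<comment> \<open>\<open>PrimRec\<close> recurses on its first argument, so the recursion depth is
    placed in front of the unchanged parameters.\<close>
  let ?Gs = "n # map (\<lambda>i xs. xs ! i) [0..<k]"
  have "computable k (\<lambda>xs. ?F (hd (map (\<lambda>G. G xs) ?Gs)) (tl (map (\<lambda>G. G xs) ?Gs)))"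
    by (rule computable_compose[where F = "\<lambda>ys. ?F (hd ys) (tl ys)"])
       (use F n in \<open>auto intro: computable_nth\<close>)
  then show ?thesis
    by (rule computable_cong) (auto simp: comp_def map_nth)
qed

lemma computable_funpow:
  assumes "computable1 f" "computable k n" "computable k b"
  shows "computable k (\<lambda>xs. (f ^^ n xs) (b xs))"
proof -
  have "computable k (\<lambda>xs. rec_nat (b xs) (\<lambda>i y. f y) (n xs))"
    using assms by (intro computable_rec_nat computable_apply1[OF assms(1)] computable_nth) auto
  moreover have "rec_nat x (\<lambda>i y. f y) m = (f ^^ m) x" for x m
    by (induction m) auto
  ultimately show ?thesis by simp
qed

section \<open>Arithmetic, tests and bounded search\<close>

lemma computable_add:
  assumes "computable k f" "computable k g"
  shows "computable k (\<lambda>xs. f xs + g xs)"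
proof -
  have "computable k (\<lambda>xs. (Suc ^^ f xs) (g xs))"
    by (intro computable_funpow computable_Suc computable_nth assms) simp
  moreover have "(Suc ^^ m) n = m + n" for m n
    by (induction m) auto
  ultimately show ?thesis by simp
qed

lemma computable_sum:
  assumes n: "computable k n" and s: "computable (Suc k) (\<lambda>ys. s (ys ! 0) (tl ys))"
  shows "computable k (\<lambda>xs. \<Sum>i<n xs. s i xs)"
proof -
  have "computable (Suc (Suc k)) (\<lambda>xs. s (xs ! 0) (drop 2 xs))"
  proof -
    \<comment> \<open>The summand sees the counter and the parameters; the running total at index 1
      is skipped.\<close>
    let ?Gs = "(\<lambda>xs. xs ! 0) # map (\<lambda>i xs. xs ! (2 + i)) [0..<k]"
    have "computable (Suc (Suc k)) (\<lambda>xs. s ((map (\<lambda>G. G xs) ?Gs) ! 0) (tl (map (\<lambda>G. G xs) ?Gs)))"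
      by (rule computable_compose[where F = "\<lambda>ys. s (ys ! 0) (tl ys)"])
         (use s in \<open>auto intro: computable_nth\<close>)
    then show ?thesis
      by (rule computable_cong) (auto intro!: arg_cong[of _ _ "s _"] nth_equalityI)
  qed
  then have "computable k (\<lambda>xs. rec_nat 0 (\<lambda>i y. y + s i xs) (n xs))"
    by (intro computable_rec_nat n computable_const computable_add computable_nth) auto
  moreover have "rec_nat 0 (\<lambda>i y. y + s i xs) m = (\<Sum>i<m. s i xs)" for xs m
    by (induction m) auto
  ultimately show ?thesis by simp
qed

lemma computable_mult:
  assumes "computable k f" "computable k g"
  shows "computable k (\<lambda>xs. f xs * g xs)"
proof -
  have "computable k (\<lambda>xs. rec_nat 0 (\<lambda>i y. g xs + y) (f xs))"
    using computable_drop[OF assms(2), of 2]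
    by (intro computable_rec_nat assms computable_const computable_add computable_nth) auto
  moreover have "rec_nat 0 (\<lambda>i y. n + y) m = m * n" for m n :: nat
    by (induction m) auto
  ultimately show ?thesis by simp
qed

lemma computable_diff:
  assumes "computable k f" "computable k g"
  shows "computable k (\<lambda>xs. f xs - g xs)"
proof -
  \<comment> \<open>The predecessor is the recursion that returns its counter; iterating it gives
    truncated subtraction.\<close>
  have "computable1 (\<lambda>n. rec_nat 0 (\<lambda>i y. i) n)"
    by (intro computable_rec_nat computable_const computable_nth) auto
  moreover have "rec_nat 0 (\<lambda>i y. i) n = n - 1" for n :: nat
    by (cases n) auto
  ultimately have "computable1 (\<lambda>n. n - 1)" by simp
  then have "computable k (\<lambda>xs. ((\<lambda>n. n - 1) ^^ g xs) (f xs))"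
    using assms by (intro computable_funpow)
  moreover have "((\<lambda>n. n - 1) ^^ m) n = n - m" for m n :: nat
    by (induction m) auto
  ultimately show ?thesis by simp
qed

lemma computable_power:
  assumes "computable k f"
  shows "computable k (\<lambda>xs. c ^ f xs)"
proof -
  have "computable k (\<lambda>xs. ((*) c ^^ f xs) 1)"
    by (intro computable_funpow computable_mult computable_const computable_nth assms) simp
  moreover have "((*) c ^^ m) 1 = c ^ m" for m
    by (induction m) auto
  ultimately show ?thesis by simp
qed

lemma computable_conj:
  assumes "computable k (\<lambda>xs. of_bool (P xs))" "computable k (\<lambda>xs. of_bool (Q xs))"
  shows "computable k (\<lambda>xs. of_bool (P xs \<and> Q xs))"
  using computable_mult[OF assms] by (simp add: of_bool_conj)

lemma computable_eq:
  assumes "computable k f" "computable k g"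
  shows "computable k (\<lambda>xs. of_bool (f xs = g xs))"
proof -
  \<comment> \<open>With truncated subtraction the sum of the two differences is 0 exactly when the
    values agree, and \<open>1 - d\<close> then serves as the test for \<open>d = 0\<close>.\<close>
  have "computable k (\<lambda>xs. 1 - ((f xs - g xs) + (g xs - f xs)))"
    by (intro computable_diff computable_add computable_const assms)
  then show ?thesis by (rule computable_cong) auto
qed

lemma computable_if:
  assumes "computable k (\<lambda>xs. of_bool (P xs))" "computable k f" "computable k g"
  shows "computable k (\<lambda>xs. if P xs then f xs else g xs)"
proof -
  have "computable k (\<lambda>xs. of_bool (P xs) * f xs + (1 - of_bool (P xs)) * g xs)"
    by (intro computable_diff computable_add computable_mult computable_const assms)
  then show ?thesis by (rule computable_cong) auto
qed

lemma computable_bex: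
  assumes "computable k n" "computable (Suc k) (\<lambda>ys. of_bool (P (ys ! 0) (tl ys)))"
  shows "computable k (\<lambda>xs. of_bool (\<exists>i<n xs. P i xs))"
proof -
  \<comment> \<open>The sum counts the witnesses, and \<open>1 - (1 - m)\<close> cuts the count down
    to 0 or 1.\<close>
  have "computable k (\<lambda>xs. 1 - (1 - (\<Sum>i<n xs. of_bool (P i xs))))"
    by (intro computable_diff computable_sum computable_const assms)
  then show ?thesis
  proof (rule computable_cong)
    fix xs
    define m where "m = (\<Sum>i<n xs. of_bool (P i xs) :: nat)"
    have "m = 0 \<longleftrightarrow> \<not> (\<exists>i<n xs. P i xs)"
      unfolding m_def by (subst sum_eq_0_iff) auto
    then show "1 - (1 - (\<Sum>i<n xs. of_bool (P i xs))) = (of_bool (\<exists>i<n xs. P i xs) :: nat)"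
      unfolding m_def[symmetric] by (cases "m = 0") auto
  qed
qed

section \<open>Pairs and lists through their codes\<close>

lemma computable_prod_encode:
  assumes "computable k f" "computable k g"
  shows "computable k (\<lambda>xs. prod_encode (f xs, g xs))"
proof -
  have "computable1 (\<lambda>n. \<Sum>i<Suc n. i)"
    by (intro computable_sum computable_Suc computable_nth) auto
  moreover have "(\<Sum>i<Suc n. i) = triangle n" for n
    by (induction n) auto
  ultimately have "computable1 triangle" by simp
  then have "computable k (\<lambda>xs. triangle (f xs + g xs) + f xs)"
    using assms by (intro computable_add computable_apply1[OF \<open>computable1 triangle\<close>])
  then show ?thesis by (simp add: prod_encode_def)
qed

text \<open>Both components of a pair are bounded by its code, so decoding is a finite search. Since
  \<open>prod_encode\<close> is injective, exactly one pair contributes to the double sum.\<close>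

lemma computable_fst_prod_decode:
  assumes "computable k f"
  shows "computable k (\<lambda>xs. fst (prod_decode (f xs)))"
proof -
  let ?s = "\<lambda>n. \<Sum>x<Suc n. \<Sum>y<Suc n. x * of_bool (prod_encode (x, y) = n)"
  have "computable1 ?s"
    by (intro computable_sum computable_mult computable_eq computable_prod_encode
        computable_Suc) (auto intro: computable_nth computable_nth_tl)
  moreover have "?s n = fst (prod_decode n)" for n
  proof -
    obtain a b where ab: "prod_decode n = (a, b)" by force
    then have n: "n = prod_encode (a, b)" by (metis prod_decode_inverse)
    have "a < Suc n" "b < Suc n"
      using le_prod_encode_1[of a b] le_prod_encode_2[of b a] n by auto
    have "?s n = (\<Sum>x<Suc n. if x = a then a else 0)"
    proof (rule sum.cong)
      fix x
      have "(\<Sum>y<Suc n. x * of_bool (prod_encode (x, y) = n)) = (\<Sum>y<Suc n. if y = b then if x = a then a else 0 else 0)"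
        by (rule sum.cong) (auto simp: n)
      then show "(\<Sum>y<Suc n. x * of_bool (prod_encode (x, y) = n)) = (if x = a then a else 0)"
        using \<open>b < Suc n\<close> by simp
    qed simp
    then show ?thesis using \<open>a < Suc n\<close> ab by simp
  qed
  ultimately have "computable1 (\<lambda>n. fst (prod_decode n))" by (simp only:)
  then show ?thesis using assms by (rule computable_apply1)
qed

text \<open>With the first component already available, a search over the second alone
  suffices.\<close>

lemma computable_snd_prod_decode:
  assumes "computable k f"
  shows "computable k (\<lambda>xs. snd (prod_decode (f xs)))"
proof -
  let ?s = "\<lambda>n. \<Sum>y<Suc n. y * of_bool (prod_encode (fst (prod_decode n), y) = n)"
  have "computable1 ?s"
    by (intro computable_sum computable_mult computable_eq computable_prod_encode
        computable_Suc computable_fst_prod_decode) (auto intro: computable_nth computable_nth_tl)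
  moreover have "?s n = snd (prod_decode n)" for n
  proof -
    obtain a b where ab: "prod_decode n = (a, b)" by force
    then have n: "n = prod_encode (a, b)" by (metis prod_decode_inverse)
    have "b < Suc n"
      using le_prod_encode_2[of b a] n by auto
    have "?s n = (\<Sum>y<Suc n. if y = b then b else 0)"
      by (rule sum.cong) (auto simp: n)
    then show ?thesis using \<open>b < Suc n\<close> ab by simp
  qed
  ultimately have "computable1 (\<lambda>n. snd (prod_decode n))" by (simp only:)
  then show ?thesis using assms by (rule computable_apply1)
qed

lemma computable_Cons:
  assumes "computable k x" "computable k (\<lambda>xs. list_encode (l xs))"
  shows "computable k (\<lambda>xs. list_encode (x xs # l xs))"
  using computable_Suc[OF computable_prod_encode[OF assms]] by simp

lemma computable_tl:
  assumes "computable k (\<lambda>xs. list_encode (l xs))"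
  shows "computable k (\<lambda>xs. list_encode (tl (l xs)))"
proof -
  \<comment> \<open>The empty list has code 0 and a nonempty list the successor of the code of the
    pair of head and tail.\<close>
  have "computable k (\<lambda>xs. if list_encode (l xs) = 0 then 0 else snd (prod_decode (list_encode (l xs) - 1)))"
    by (intro computable_if computable_eq computable_const computable_snd_prod_decode computable_diff assms)
  then show ?thesis
  proof (rule computable_cong)
    fix xs
    show "(if list_encode (l xs) = 0 then 0 else snd (prod_decode (list_encode (l xs) - 1)))
        = list_encode (tl (l xs))"
      by (cases "l xs") auto
  qed
qed

text \<open>The default 0 replaces the unspecified value \<open>hd []\<close>.\<close>

lemma computable_hd:
  assumes "computable k (\<lambda>xs. list_encode (l xs))"
  shows "computable k (\<lambda>xs. if l xs = [] then 0 else hd (l xs))"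
proof -
  have "computable k (\<lambda>xs. if list_encode (l xs) = 0 then 0 else fst (prod_decode (list_encode (l xs) - 1)))"
    by (intro computable_if computable_eq computable_const computable_fst_prod_decode computable_diff assms)
  then show ?thesis
  proof (rule computable_cong)
    fix xs
    show "(if list_encode (l xs) = 0 then 0 else fst (prod_decode (list_encode (l xs) - 1)))
        = (if l xs = [] then 0 else hd (l xs))"
      by (cases "l xs") auto
  qed
qed

lemma computable_is_Nil:
  assumes "computable k (\<lambda>xs. list_encode (l xs))"
  shows "computable k (\<lambda>xs. of_bool (l xs = []))"
proof -
  have "computable k (\<lambda>xs. of_bool (list_encode (l xs) = list_encode []))"
    using assms by (intro computable_eq) (auto intro: computable_const)
  then show ?thesis by (simp only: list_encode_eq)
qed

text \<open>The code of a list thereby serves as a computable bound for loops over the list and,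
  later, for the length of a word.\<close>

lemma length_le_list_encode: "length l \<le> list_encode l"
proof (induction l)
  case (Cons x l)
  then show ?case using le_prod_encode_2[of "list_encode l" x] by simp
qed simp

text \<open>The rules for lists expect an argument of the form \<open>list_encode (l xs)\<close>;
  this rule supplies it when the list is given only by a code.\<close>

lemma computable_list_decode:
  "computable k f \<Longrightarrow> computable k (\<lambda>xs. list_encode (list_decode (f xs)))"
  by simp

lemma computable_foldl:
  assumes f: "computable2 f" and b: "computable k b" and l: "computable k (\<lambda>xs. list_encode (l xs))"
  shows "computable k (\<lambda>xs. foldl f (b xs) (l xs))"
proof -
  define T where "T = (\<lambda>n. list_encode (tl (list_decode n)))"
  have T: "computable1 T" unfolding T_def
    by (intro computable_tl computable_list_decode computable_nth) simp
  have T_funpow: "list_decode ((T ^^ i) (list_encode l)) = drop i l" for i l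
    by (induction i) (auto simp: T_def drop_Suc tl_drop)
  \<comment> \<open>The loop runs as often as the code of the list says, which may exceed the
    length. Round \<open>i\<close> reads the entry at index \<open>i\<close>, and once the list is
    exhausted the accumulator is left unchanged.\<close>
  define g where "g i y n = (let l = list_decode ((T ^^ i) n) in
     if l = [] then y else f y (if l = [] then 0 else hd l))" for i y n
  have "computable k (\<lambda>xs. rec_nat (b xs) (\<lambda>i y. g i y (list_encode (l xs))) (list_encode (l xs)))"
    unfolding g_def Let_def using computable_drop[OF l, of 2]
    by (intro computable_rec_nat computable_if computable_is_Nil computable_hd computable_list_decode
        computable_funpow[OF T] computable_apply2[OF f] l b computable_nth) auto
  moreover have "rec_nat c (\<lambda>i y. g i y (list_encode l)) m = foldl f c (take m l)" for c l m
  proof (induction m)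
    case (Suc m)
    then show ?case
      by (cases "length l \<le> m") (simp_all add: g_def T_funpow hd_drop_conv_nth take_Suc_conv_app_nth)
  qed simp
  ultimately show ?thesis using length_le_list_encode by simp
qed

lemma computable_rev:
  assumes "computable k (\<lambda>xs. list_encode (l xs))"
  shows "computable k (\<lambda>xs. list_encode (rev (l xs)))"
proof -
  let ?f = "\<lambda>n x. list_encode (x # list_decode n)"
  have "computable k (\<lambda>xs. foldl ?f (list_encode []) (l xs))"
    by (intro computable_foldl computable_Cons computable_list_decode computable_nth computable_const assms) auto
  moreover have "foldl ?f (list_encode l') l = list_encode (rev l @ l')" for l l'
    by (induction l arbitrary: l') (simp_all del: list_encode.simps)
  ultimately show ?thesis by (simp del: list_encode.simps)
qed

text \<open>A left fold over the reversed list; the accumulator is kept as a code because programs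
  handle numbers only.\<close>

lemma computable_foldr:
  assumes f: "computable2 (\<lambda>x n. list_encode (f x (list_decode n)))"
    and b: "computable k (\<lambda>xs. list_encode (b xs))"
    and l: "computable k (\<lambda>xs. list_encode (l xs))"
  shows "computable k (\<lambda>xs. list_encode (foldr f (l xs) (b xs)))"
proof -
  let ?g = "\<lambda>n x. list_encode (f x (list_decode n))"
  have "computable2 ?g"
    by (rule computable_apply2[OF f]) (auto intro: computable_nth)
  then have "computable k (\<lambda>xs. foldl ?g (list_encode (b xs)) (rev (l xs)))"
    by (intro computable_foldl computable_rev b l)
  moreover have "foldl ?g (list_encode b) l = list_encode (foldr f (rev l) b)" for b l
    by (induction l arbitrary: b) simp_all
  ultimately show ?thesis by simp
qed

lemma computable_funpow_list:
  assumes f: "computable1 (\<lambda>n. list_encode (f (list_decode n)))" and n: "computable k n"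
    and l: "computable k (\<lambda>xs. list_encode (l xs))"
  shows "computable k (\<lambda>xs. list_encode ((f ^^ n xs) (l xs)))"
proof -
  have "((\<lambda>n. list_encode (f (list_decode n))) ^^ m) (list_encode l) = list_encode ((f ^^ m) l)" for m l
    by (induction m) auto
  then show ?thesis using computable_funpow[OF f n l] by simp
qed

lemma computable_count_list:
  assumes "computable k (\<lambda>xs. list_encode (l xs))"
  shows "computable k (\<lambda>xs. count_list (l xs) c)"
proof -
  let ?f = "\<lambda>n x. n + of_bool (x = c)"
  have "computable k (\<lambda>xs. foldl ?f 0 (l xs))"
    by (intro computable_foldl computable_add computable_eq computable_nth computable_const assms) auto
  moreover have "foldl ?f n l = n + count_list l c" for l n
    by (induction l arbitrary: n) auto
  ultimately show ?thesis by simp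
qed


section \<open>Conjugacy in free products of groups of order two\<close>

text \<open>Left multiplication of a normal form by the involution \<open>s\<close>. Normal forms
  are the words without equal neighbours, that is, those satisfying
  \<open>distinct_adj\<close>.\<close>

fun push :: "nat \<Rightarrow> nat list \<Rightarrow> nat list" where
  "push s [] = [s]"
| "push s (t # w) = (if t = s then w else s # t # w)"

definition rpush :: "nat \<Rightarrow> nat list \<Rightarrow> nat list" where
  "rpush s w = rev (push s (rev w))"

definition red :: "nat list \<Rightarrow> nat list" where
  "red w = foldr push w []"

fun rot :: "nat list \<Rightarrow> nat list" where
  "rot [] = []"
| "rot (s # w) = rpush s w"

lemma red_simps [simp]: "red [] = []" "red (s # w) = push s (red w)"
  by (simp_all add: red_def)

lemma distinct_adj_push: "distinct_adj w \<Longrightarrow> distinct_adj (push s w)"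
  by (cases "(s, w)" rule: push.cases) (auto simp: distinct_adj_Cons)

lemma distinct_adj_rpush: "distinct_adj w \<Longrightarrow> distinct_adj (rpush s w)"
  by (simp add: rpush_def distinct_adj_push)

lemma distinct_adj_red: "distinct_adj (red w)"
  by (induction w) (auto intro: distinct_adj_push)

lemma distinct_adj_rot: "distinct_adj w \<Longrightarrow> distinct_adj (rot w)"
  by (cases w) (auto simp: distinct_adj_Cons intro: distinct_adj_rpush)

lemma push_eq_Cons: "distinct_adj (s # w) \<Longrightarrow> push s w = s # w"
  by (cases w) auto

text \<open>This is the relation \<open>s^2 = 1\<close>, acting on normal forms. On the unreduced
  word \<open>s # s # w\<close> two pushes would remove both letters instead.\<close>

lemma push_push: "distinct_adj w \<Longrightarrow> push s (push s w) = w"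
  by (cases "(s, w)" rule: push.cases) (auto simp: push_eq_Cons)

lemma rpush_rpush: "distinct_adj w \<Longrightarrow> rpush s (rpush s w) = w"
  by (simp add: rpush_def push_push)

lemma red_idem: "distinct_adj w \<Longrightarrow> red w = w"
proof (induction w)
  case (Cons s w)
  then show ?case using push_eq_Cons[of s w] by (auto simp: distinct_adj_Cons)
qed simp

lemma red_red [simp]: "red (red w) = red w"
  by (intro red_idem distinct_adj_red)

lemma rpush_snoc: "rpush s (w @ [t]) = (if t = s then w else w @ [t, s])"
  by (simp add: rpush_def)

text \<open>On words of length at least two the two multiplications act at different positions; for
  shorter words both may touch the same letter, and these are checked separately.\<close>

lemma push_rpush:
  assumes "distinct_adj w"
  shows "push s (rpush t w) = rpush t (push s w)"
proof (cases w rule: rev_cases)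
  case Nil
  then show ?thesis by (simp add: rpush_def)
next
  case (snoc v r)
  show ?thesis
  proof (cases v)
    case Nil
    with snoc show ?thesis by (auto simp: rpush_def)
  next
    case (Cons q m)
    with snoc rpush_snoc[of t "q # m" r] rpush_snoc[of t "m" r] rpush_snoc[of t "s # q # m" r]
    show ?thesis by auto
  qed
qed

text \<open>\<open>red\<close> multiplies from the left; since left and right multiplication
  commute, it can be evaluated from the right as well.\<close>

lemma red_snoc: "red (w @ [s]) = rpush s (red w)"
proof (induction w)
  case (Cons t w)
  then show ?case by (simp add: push_rpush distinct_adj_red)
qed (simp add: rpush_def)

lemma red_append_cong:
  assumes "red x = red y"
  shows "red (p @ x @ q) = red (p @ y @ q)"
proof -
  \<comment> \<open>The right context grows letter by letter through \<open>red_snoc\<close>, the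
    left one through the definition of \<open>red\<close>.\<close>
  have "red (x @ q) = red (y @ q)"
  proof (induction q rule: rev_induct)
    case (snoc s q)
    then show ?case by (metis append_assoc red_snoc)
  qed (simp add: assms)
  then show ?thesis by (induction p) auto
qed

lemma red_rev_cancel: "red (p @ rev g @ g @ q) = red (p @ q)"
proof (induction g arbitrary: q)
  case (Cons s g)
  \<comment> \<open>Each generator is its own inverse, so the two equal letters at the seam cancel
    first.\<close>
  have "red (rev g @ (s # s # g @ q)) = red (rev g @ g @ q)"
    using red_append_cong[of "[s, s]" "[]" "rev g" "g @ q"] by simp
  from red_append_cong[OF this, of p "[]"] show ?case using Cons[of q] by simp
qed simp

text \<open>In the free product of groups of order two, \<open>red\<close> computes normal forms and \<open>rev\<close> inverses.\<close>

definition conj_red :: "nat \<Rightarrow> nat list \<Rightarrow> nat list \<Rightarrow> bool" where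
  "conj_red n u v \<longleftrightarrow> (\<exists>g. set g \<subseteq> {..<n} \<and> red (g @ u @ rev g) = red v)"

lemma conj_red_refl: "red u = red v \<Longrightarrow> conj_red n u v"
  unfolding conj_red_def by (rule exI[of _ "[]"]) simp

lemma conj_red_sym:
  assumes "conj_red n u v"
  shows "conj_red n v u"
proof -
  obtain g where g: "set g \<subseteq> {..<n}" "red (g @ u @ rev g) = red v"
    using assms unfolding conj_red_def by blast
  have "red (rev g @ v @ g) = red (rev g @ (g @ u @ rev g) @ g)"
    using g by (intro red_append_cong) simp
  also have "\<dots> = red u"
    using red_rev_cancel[of "[]" g "u @ rev g @ g"] red_rev_cancel[of u g "[]"] by simp
  finally show ?thesis using g(1) unfolding conj_red_def by (intro exI[of _ "rev g"]) simp
qed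

lemma conj_red_trans:
  assumes "conj_red n u v" "conj_red n v w"
  shows "conj_red n u w"
proof -
  obtain g h where g: "set g \<subseteq> {..<n}" "red (g @ u @ rev g) = red v"
    and h: "set h \<subseteq> {..<n}" "red (h @ v @ rev h) = red w"
    using assms unfolding conj_red_def by blast
  have "red (h @ (g @ u @ rev g) @ rev h) = red w"
    using red_append_cong[OF g(2)] h(2) by metis
  with g(1) h(1) show ?thesis unfolding conj_red_def by (intro exI[of _ "h @ g"]) simp
qed

lemma set_push: "set (push s w) \<subseteq> insert s (set w)"
  by (cases "(s, w)" rule: push.cases) auto

lemma set_rpush: "set (rpush s w) \<subseteq> insert s (set w)"
  using set_push[of s "rev w"] by (simp add: rpush_def)

lemma set_rot: "set (rot w) \<subseteq> set w"
  using set_rpush by (cases w) auto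

lemma length_push: "length (push s w) \<le> Suc (length w)"
  by (cases "(s, w)" rule: push.cases) auto

lemma length_rot: "length (rot w) \<le> length w"
proof (cases w)
  case (Cons s v)
  then show ?thesis using length_push[of s "rev v"] by (simp add: rpush_def)
qed simp

lemma set_red: "set (red w) \<subseteq> set w"
  by (induction w) (use set_push in force)+

lemma length_red: "length (red w) \<le> length w"
proof (induction w)
  case (Cons s w)
  then show ?case using length_push[of s "red w"] by simp
qed simp

lemma conj_red_rot:
  assumes "distinct_adj w" "set w \<subseteq> {..<n}"
  shows "conj_red n w (rot w)"
proof (cases w)
  case (Cons s v)
  have "red (v @ [s]) = rpush s v"
    using assms Cons by (auto simp: red_snoc red_idem distinct_adj_Cons)
  also have "\<dots> = red (rot w)"
    using assms Cons by (auto simp: red_idem distinct_adj_Cons distinct_adj_rpush)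
  finally show ?thesis
    using assms Cons red_append_cong[of "[s, s]" "[]" "[]" "v @ [s]"]
    unfolding conj_red_def by (intro exI[of _ "[s]"]) simp
qed (simp add: conj_red_refl)

text \<open>The orbit stays inside one conjugacy class, which makes meeting orbits imply conjugacy,
  and inside a finite set of words, which makes the search bounded.\<close>

lemma funpow_rot:
  assumes "distinct_adj w" "set w \<subseteq> {..<n}"
  shows "distinct_adj ((rot ^^ i) w) \<and> set ((rot ^^ i) w) \<subseteq> {..<n}
    \<and> length ((rot ^^ i) w) \<le> length w \<and> conj_red n w ((rot ^^ i) w)"
proof (induction i)
  case (Suc i)
  then show ?case
    using distinct_adj_rot set_rot[of "(rot ^^ i) w"] length_rot[of "(rot ^^ i) w"]
      conj_red_rot[of "(rot ^^ i) w" n] conj_red_trans[of n w "(rot ^^ i) w"]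
    by auto
qed (use assms conj_red_refl in auto)

section \<open>Conjugacy as meeting of orbits\<close>

text \<open>If \<open>w\<close> starts with \<open>s\<close>, conjugation by \<open>s\<close> is
  \<open>rot\<close> itself. If a nonempty \<open>w\<close> does not, then its conjugate
  \<open>v\<close> starts with \<open>s\<close>, and conjugating back by \<open>s\<close> is
  \<open>rot\<close> applied to \<open>v\<close>. The empty word is fixed.\<close>

lemma rot_conj_letter:
  assumes "distinct_adj w" "v = push s (rpush s w)"
  shows "rot w = v \<or> rot v = w"
proof -
  \<comment> \<open>The left multiplication by \<open>s\<close> removes the first letter and the
    right one puts it at the end or cancels it there.\<close>
  have *: "rot (s # m) = push s (rpush s (s # m))" if "distinct_adj (s # m)" for m
    using that by (simp add: push_rpush)
  have v: "distinct_adj v" using assms by (simp add: distinct_adj_push distinct_adj_rpush)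
  have w: "w = push s (rpush s v)"
    using assms by (simp add: push_push rpush_rpush distinct_adj_push distinct_adj_rpush flip: push_rpush)
  have v': "v = rpush s (push s w)" using assms by (simp add: push_rpush)
  show ?thesis
  proof (cases w rule: rev_cases)
    case Nil
    then show ?thesis using assms by (simp add: rpush_def)
  next
    case (snoc m r)
    show ?thesis
    proof (cases "hd w = s")
      case True
      then have "w = s # tl w" using snoc by (metis Nil_is_append_conv list.collapse list.distinct(1))
      then show ?thesis using * assms by metis
    next
      case False
      moreover have "w \<noteq> []" using snoc by simp
      ultimately have "push s w = s # w" by (cases w) auto
      then have "v = s # (if r = s then m else w @ [s])"
        using v' snoc rpush_snoc[of s "s # m" r] by auto
      then show ?thesis using * v w by metis
    qed
  qed
qed

definition rot_equiv :: "nat list \<Rightarrow> nat list \<Rightarrow> bool" where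
  "rot_equiv u v \<longleftrightarrow> (\<exists>i j. (rot ^^ i) u = (rot ^^ j) v)"

text \<open>Two points on the orbit of \<open>v\<close> flow together under further iteration,
  because iterates of \<open>rot\<close> commute.\<close>

lemma rot_equiv_trans:
  assumes "rot_equiv u v" "rot_equiv v w"
  shows "rot_equiv u w"
proof -
  obtain i j k l where *: "(rot ^^ i) u = (rot ^^ j) v" "(rot ^^ k) v = (rot ^^ l) w"
    using assms unfolding rot_equiv_def by blast
  have "(rot ^^ (k + i)) u = (rot ^^ (k + j)) v" using * by (simp add: funpow_add)
  also have "\<dots> = (rot ^^ (j + l)) w"
    using * by (subst add.commute) (simp add: funpow_add)
  finally show ?thesis unfolding rot_equiv_def by blast
qed

text \<open>The conjugator is built up one letter at a time; each letter costs one application of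
  \<open>rot\<close>, forwards or backwards.\<close>

lemma rot_equiv_conj: "rot_equiv (red u) (red (g @ u @ rev g))"
proof (induction g)
  case Nil
  then show ?case unfolding rot_equiv_def by auto
next
  case (Cons s g)
  let ?w = "red (g @ u @ rev g)"
  have "red ((s # g) @ u @ rev (s # g)) = push s (rpush s ?w)"
    by (simp flip: red_snoc)
  then have "rot ?w = red ((s # g) @ u @ rev (s # g)) \<or> rot (red ((s # g) @ u @ rev (s # g))) = ?w"
    by (intro rot_conj_letter distinct_adj_red)
  then have "(rot ^^ 1) ?w = (rot ^^ 0) (red ((s # g) @ u @ rev (s # g)))
      \<or> (rot ^^ 0) ?w = (rot ^^ 1) (red ((s # g) @ u @ rev (s # g)))"
    by (simp only: One_nat_def funpow.simps comp_apply id_apply) metis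
  then have "rot_equiv ?w (red ((s # g) @ u @ rev (s # g)))"
    unfolding rot_equiv_def by blast
  with Cons show ?case by (rule rot_equiv_trans)
qed

text \<open>In the direction from orbits to conjugacy, every application of \<open>rot\<close>
  conjugates by a letter of the word itself, so the conjugator uses only generators below
  \<open>n\<close>.\<close>

lemma conj_red_iff_rot_equiv:
  assumes "set u \<subseteq> {..<n}" "set v \<subseteq> {..<n}"
  shows "conj_red n u v \<longleftrightarrow> rot_equiv (red u) (red v)"
proof
  assume "conj_red n u v"
  then show "rot_equiv (red u) (red v)"
    unfolding conj_red_def using rot_equiv_conj by metis
next
  assume "rot_equiv (red u) (red v)"
  then obtain i j where ij: "(rot ^^ i) (red u) = (rot ^^ j) (red v)"
    unfolding rot_equiv_def by blast
  have "conj_red n (red u) ((rot ^^ i) (red u))" "conj_red n (red v) ((rot ^^ j) (red v))"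
    using assms set_red[of u] set_red[of v] funpow_rot[OF distinct_adj_red] by auto
  then have "conj_red n (red u) (red v)"
    using ij conj_red_sym conj_red_trans by metis
  moreover have "conj_red n u (red u)" "conj_red n (red v) v"
    by (auto intro: conj_red_refl)
  ultimately show "conj_red n u v" using conj_red_trans by blast
qed

section \<open>Bounds for the search\<close>

text \<open>Among the first \<open>card S + 1\<close> iterates two coincide, say those at
  \<open>p < q\<close>. Every exponent \<open>i \<ge> card S\<close> can then be lowered by
  \<open>q - p\<close> without changing the iterate.\<close>

lemma funpow_pigeonhole:
  fixes f :: "'a \<Rightarrow> 'a"
  assumes "finite S" "\<And>i. (f ^^ i) x \<in> S"
  shows "\<exists>j<card S. (f ^^ j) x = (f ^^ i) x"
proof (induction i rule: less_induct)
  case (less i)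
  show ?case
  proof (cases "i < card S")
    case False
    have "\<not> inj_on (\<lambda>i. (f ^^ i) x) {..card S}"
      using card_inj_on_le[of "\<lambda>i. (f ^^ i) x" "{..card S}" S] assms
      by (auto simp: image_subset_iff)
    then obtain p q where pq: "p < q" "q \<le> card S" "(f ^^ p) x = (f ^^ q) x"
      unfolding inj_on_def by (metis (no_types) atMost_iff linorder_neqE_nat)
    have "(f ^^ (i - q + p)) x = (f ^^ (i - q + q)) x"
      by (simp add: funpow_add pq(3))
    then have "(f ^^ (i - q + p)) x = (f ^^ i) x" using pq(2) False by simp
    moreover have "i - q + p < i" using pq False by simp
    ultimately show ?thesis using less[of "i - q + p"] by simp
  qed auto
qed

text \<open>The geometric sum is replaced by a single power, which is simple to compute.\<close>

lemma card_words_le: "card {w :: nat list. set w \<subseteq> {..<n} \<and> length w \<le> l} \<le> Suc n ^ l"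
proof -
  have "(\<Sum>i\<le>l. n ^ i) \<le> Suc n ^ l"
  proof (induction l)
    case (Suc l)
    have "(\<Sum>i\<le>Suc l. n ^ i) \<le> Suc n ^ l + n * n ^ l" using Suc by simp
    also have "\<dots> \<le> Suc n ^ l + n * Suc n ^ l"
      by (intro add_left_mono mult_left_mono power_mono) auto
    finally show ?case by simp
  qed simp
  then show ?thesis using card_lists_length_le[of "{..<n}" l] by simp
qed

text \<open>Upper bounds \<open>k\<close> and \<open>l\<close> for the lengths are allowed so that
  the codes of the words can be inserted later.\<close>

lemma rot_equiv_iff_bounded:
  assumes "set u \<subseteq> {..<n}" "set v \<subseteq> {..<n}" "length u \<le> k" "length v \<le> l"
    "distinct_adj u" "distinct_adj v"
  shows "rot_equiv u v \<longleftrightarrow> (\<exists>i<Suc n ^ k. \<exists>j<Suc n ^ l. (rot ^^ i) u = (rot ^^ j) v)"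
proof -
  have *: "\<exists>j<Suc n ^ k. (rot ^^ j) u = (rot ^^ i) u"
    if "set u \<subseteq> {..<n}" "length u \<le> k" "distinct_adj u" for u k i
  proof -
    let ?S = "{w. set w \<subseteq> {..<n} \<and> length w \<le> k}"
    have "finite ?S" by (intro finite_lists_length_le) simp
    moreover have "(rot ^^ i) u \<in> ?S" for i
      using funpow_rot[OF that(3,1), of i] that(2) by simp
    ultimately show ?thesis
      using funpow_pigeonhole[of ?S rot u i] card_words_le[of n k] by (blast intro: order.strict_trans2)
  qed
  show ?thesis
  proof
    assume "rot_equiv u v"
    then obtain i j where "(rot ^^ i) u = (rot ^^ j) v" unfolding rot_equiv_def by blast
    moreover obtain i' where "i' < Suc n ^ k" "(rot ^^ i') u = (rot ^^ i) u"
      using *[OF assms(1,3,5)] by blast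
    moreover obtain j' where "j' < Suc n ^ l" "(rot ^^ j') v = (rot ^^ j) v"
      using *[OF assms(2,4,6)] by blast
    ultimately show "\<exists>i<Suc n ^ k. \<exists>j<Suc n ^ l. (rot ^^ i) u = (rot ^^ j) v" by metis
  next
    assume "\<exists>i<Suc n ^ k. \<exists>j<Suc n ^ l. (rot ^^ i) u = (rot ^^ j) v"
    then show "rot_equiv u v" unfolding rot_equiv_def by blast
  qed
qed


section \<open>The word and conjugacy relations of the torus braid group\<close>

abbreviation B2_eq :: "word \<Rightarrow> word \<Rightarrow> bool" (infix "\<approx>" 50) where
  "u \<approx> v \<equiv> word_eq 3 B2_torus_relations u v"

declare word_eq.trans [trans]

lemma B2_eq_mid:
  assumes "u \<approx> v" "p \<in> words 3" "q \<in> words 3"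
  shows "p @ u @ q \<approx> p @ v @ q"
  using assms by (intro word_eq_append) (auto intro: word_eq.refl)

lemma B2_eq_relation:
  assumes "(l, r) \<in> B2_torus_relations"
  shows "l \<approx> r"
proof -
  have "l \<in> words 3" "r \<in> words 3"
    using assms by (auto simp: B2_torus_relations_def Let_def)
  then show ?thesis using word_eq.relation[of "[]" 3 "[]"] assms by simp
qed

section \<open>Invariants\<close>

text \<open>The exponent sum over the generators in \<open>S\<close>. The sets \<open>{0, 2}\<close>
  and \<open>{1, 2}\<close> count \<open>c\<close> together with exactly one of \<open>a\<close> and
  \<open>b\<close>, so both sums respect \<open>a^2 b^2 = c^2\<close>.\<close>

definition weight :: "nat set \<Rightarrow> word \<Rightarrow> int" where
  "weight S w = (\<Sum>(i, s)\<leftarrow>w. if i \<in> S then if s then 1 else -1 else 0)"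

lemma weight_simps [simp]:
  "weight S [] = 0"
  "weight S ((i, s) # w) = (if i \<in> S then if s then 1 else -1 else 0) + weight S w"
  "weight S (u @ v) = weight S u + weight S v"
  by (simp_all add: weight_def)

lemma weight_replicate [simp]: "weight S (replicate n (i, s)) = int n * weight S [(i, s)]"
  by (induction n) (auto simp: algebra_simps)

text \<open>Once signs are forgotten, inverse pairs become squares and cancel. The two sides of a
  commutation relation reduce to the same single letter, those of \<open>a^2 b^2 = c^2\<close> to
  the empty word.\<close>

lemma B2_eq_invariants:
  assumes "u \<approx> v"
  shows "weight {0, 2} u = weight {0, 2} v \<and> weight {1, 2} u = weight {1, 2} v
    \<and> red (map fst u) = red (map fst v)"
  using assms
proof (induction rule: word_eq.induct)
  case (cancel u v i s)
  then show ?case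
    using red_append_cong[of "[i, i]" "[]" "map fst u" "map fst v"] by simp
next
  case (relation u v l r)
  then have "weight {0, 2} l = weight {0, 2} r" "weight {1, 2} l = weight {1, 2} r"
    and "red (map fst l) = red (map fst r)"
    by (auto simp: B2_torus_relations_def Let_def)
  then show ?case
    using red_append_cong[of "map fst l" "map fst r" "map fst u" "map fst v"] by simp
qed auto

section \<open>Central squares\<close>

definition central :: "word \<Rightarrow> bool" where
  "central x \<longleftrightarrow> x \<in> words 3 \<and> (\<forall>w\<in>words 3. x @ w \<approx> w @ x)"

lemma central_append:
  assumes "central x" "central y"
  shows "central (x @ y)"
  unfolding central_def
proof (intro conjI ballI)
  fix w assume w: "w \<in> words 3"
  have "x @ y @ w \<approx> x @ w @ y"
    using B2_eq_mid[of "y @ w" "w @ y" x "[]"] assms w by (simp add: central_def)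
  also have "\<dots> \<approx> w @ x @ y"
    using B2_eq_mid[of "x @ w" "w @ x" "[]" y] assms w by (simp add: central_def)
  finally show "(x @ y) @ w \<approx> w @ x @ y" by simp
qed (use assms in \<open>auto simp: central_def\<close>)

lemma centralI:
  assumes "x \<in> words 3" "\<And>j s. j < 3 \<Longrightarrow> x @ [(j, s)] \<approx> [(j, s)] @ x"
  shows "central x"
  unfolding central_def
proof (intro conjI ballI)
  fix w :: word assume "w \<in> words 3"
  then show "x @ w \<approx> w @ x"
  proof (induction w)
    case (Cons l w)
    obtain j s where l: "l = (j, s)" by force
    have "x @ l # w \<approx> l # x @ w"
      using B2_eq_mid[of "x @ [l]" "[l] @ x" "[]" w] assms(2)[of j s] Cons.prems l by simp
    also have "\<dots> \<approx> l # w @ x"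
      using B2_eq_mid[of "x @ w" "w @ x" "[l]" "[]"] Cons l by simp
    finally show ?case by simp
  qed (use assms in \<open>auto intro: word_eq.refl\<close>)
qed (use assms in simp)

text \<open>Insert \<open>x @ x'\<close> on the right, commute \<open>y\<close> past
  \<open>x\<close>, and cancel \<open>x' @ x\<close> on the left. It serves to pass both to inverse
  letters and to inverse squares.\<close>

lemma commute_inverse:
  assumes xy: "x @ y \<approx> y @ x" and inv: "x @ x' \<approx> []" "x' @ x \<approx> []"
  shows "x' @ y \<approx> y @ x'"
proof -
  have w: "x \<in> words 3" "y \<in> words 3" "x' \<in> words 3"
    using word_eq_words[OF xy] word_eq_words[OF inv(1)] by auto
  have "x' @ y \<approx> x' @ y @ x @ x'"
    using B2_eq_mid[OF word_eq.sym[OF inv(1)], of "x' @ y" "[]"] w by simp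
  also have "\<dots> \<approx> x' @ x @ y @ x'"
    using B2_eq_mid[OF word_eq.sym[OF xy], of x' x'] w by simp
  also have "\<dots> \<approx> y @ x'"
    using B2_eq_mid[OF inv(2), of "[]" "y @ x'"] w by simp
  finally show ?thesis .
qed

lemma letter_cancel: "i < 3 \<Longrightarrow> [(i, s), (i, \<not> s)] \<approx> []"
  using word_eq.cancel[of "[]" 3 "[]" i _ s] by simp

lemma square_cancel:
  assumes "i < 3"
  shows "[(i, s), (i, s)] @ [(i, \<not> s), (i, \<not> s)] \<approx> []"
proof -
  have "[(i, s), (i, s)] @ [(i, \<not> s), (i, \<not> s)] \<approx> [(i, s), (i, \<not> s)]"
    using B2_eq_mid[OF letter_cancel[OF assms], of "[(i, s)]" "[(i, \<not> s)]"] assms by simp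
  also have "\<dots> \<approx> []" using assms by (rule letter_cancel)
  finally show ?thesis .
qed

text \<open>The relations give commutation of a positive square with the other positive letters.
  Inverting first the letter and then the square covers all signs.\<close>

lemma central_square:
  assumes "i < 2"
  shows "central [(i, t), (i, t)]"
proof -
  have TT: "[(i, True), (i, True)] @ [(j, True)] \<approx> [(j, True)] @ [(i, True), (i, True)]"
    if "j < 3" for j
  proof (cases "i = j")
    case True
    then show ?thesis using assms by (auto intro: word_eq.refl)
  next
    case False
    have "i = 0 \<or> i = 1" "j = 0 \<or> j = 1 \<or> j = 2" using assms that by auto
    with False have "([(i, True), (i, True)] @ [(j, True)], [(j, True)] @ [(i, True), (i, True)])
        \<in> B2_torus_relations"
      by (auto simp: B2_torus_relations_def Let_def)
    then show ?thesis by (rule B2_eq_relation)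
  qed
  have T: "[(i, True), (i, True)] @ [(j, s)] \<approx> [(j, s)] @ [(i, True), (i, True)]"
    if "j < 3" for j s
  proof (cases s)
    case False
    have "[(j, False)] @ [(i, True), (i, True)] \<approx> [(i, True), (i, True)] @ [(j, False)]"
      using commute_inverse[of "[(j, True)]" "[(i, True), (i, True)]" "[(j, False)]"]
        word_eq.sym[OF TT[OF that]] letter_cancel[OF that, of True] letter_cancel[OF that, of False]
      by simp
    then show ?thesis using False by (simp add: word_eq.sym)
  qed (use TT that in simp)
  have i: "i < 3" using assms by simp
  have "[(i, t), (i, t)] @ [(j, s)] \<approx> [(j, s)] @ [(i, t), (i, t)]" if "j < 3" for j s
  proof (cases t)
    case False
    have "[(i, False), (i, False)] @ [(j, s)] \<approx> [(j, s)] @ [(i, False), (i, False)]"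
      using commute_inverse[OF T[OF that, of s], of "[(i, False), (i, False)]"] square_cancel[OF i, of True] square_cancel[OF i, of False]
      by simp
    then show ?thesis using False by simp
  qed (use T that in simp)
  then show ?thesis using i by (intro centralI) simp_all
qed

definition sq_power :: "nat \<Rightarrow> int \<Rightarrow> word" where
  "sq_power i k = replicate (2 * nat \<bar>k\<bar>) (i, 0 \<le> k)"

lemma central_sq_power:
  assumes "i < 2"
  shows "central (sq_power i k)"
proof -
  have "central (replicate (2 * n) (i, t))" for n t
  proof (induction n)
    case 0
    then show ?case by (simp add: central_def word_eq.refl)
  next
    case (Suc n)
    then show ?case using central_append[OF central_square[OF assms, of t] Suc] by simp
  qed
  then show ?thesis unfolding sq_power_def by blast
qed

lemma weight_sq_power: "weight S (sq_power i k) = (if i \<in> S then 2 * k else 0)"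
  by (auto simp: sq_power_def)

lemma sq_power_words: "i < 2 \<Longrightarrow> sq_power i k \<in> words 3"
  using central_sq_power central_def by blast

text \<open>A square pointing away from exponent 0 merely lengthens the word; one pointing towards 0
  cancels against the first two letters.\<close>

lemma sq_power_step:
  assumes "i < 2"
  shows "[(i, t), (i, t)] @ sq_power i k \<approx> sq_power i (if t then k + 1 else k - 1)"
proof (cases "(if t then 0 \<le> k else k \<le> 0)")
  case True
  have "[(i, t), (i, t)] @ sq_power i k = sq_power i (if t then k + 1 else k - 1)"
  \<comment> \<open>At \<open>k = 0\<close> the convention assigns the sign \<open>True\<close> to
    the empty power, so \<open>t = False\<close> does not follow the general pattern and this
    exponent is computed separately.\<close>
  proof (cases "k = 0")
    case False
    have "nat \<bar>if t then k + 1 else k - 1\<bar> = Suc (nat \<bar>k\<bar>)" using True by auto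
    then show ?thesis using True False by (auto simp: sq_power_def)
  qed (simp add: sq_power_def numeral_2_eq_2)
  moreover have "[(i, t), (i, t)] @ sq_power i k \<in> words 3"
    using assms sq_power_words by simp
  ultimately show ?thesis using word_eq.refl by metis
next
  case False
  let ?k = "if t then k + 1 else k - 1"
  have "nat \<bar>k\<bar> = Suc (nat \<bar>?k\<bar>)" using False by (auto split: if_splits)
  then have "sq_power i k = [(i, \<not> t), (i, \<not> t)] @ sq_power i ?k"
    using False by (auto simp: sq_power_def split: if_splits)
  then show ?thesis
    using B2_eq_mid[OF square_cancel, of i "[]" "sq_power i ?k" t] assms sq_power_words by simp
qed

lemma ab_square_sq_powers:
  assumes "i < 2"
  shows "\<exists>k' l'. [(i, t), (i, t)] @ sq_power 0 k @ sq_power 1 l \<approx> sq_power 0 k' @ sq_power 1 l'"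
proof (cases "i = 0")
  case True
  then show ?thesis
    using B2_eq_mid[OF sq_power_step[of 0 t k], of "[]" "sq_power 1 l"] sq_power_words by auto
next
  case False
  with assms have i: "i = 1" by simp
  have "[(i, t), (i, t)] @ sq_power 0 k @ sq_power 1 l \<approx> sq_power 0 k @ [(i, t), (i, t)] @ sq_power 1 l"
    using B2_eq_mid[of "[(i, t), (i, t)] @ sq_power 0 k" "sq_power 0 k @ [(i, t), (i, t)]" "[]" "sq_power 1 l"]
      central_square[OF assms, of t] sq_power_words by (simp add: central_def)
  also have "\<dots> \<approx> sq_power 0 k @ sq_power 1 (if t then l + 1 else l - 1)"
    using B2_eq_mid[OF sq_power_step[of 1 t l], of "sq_power 0 k" "[]"] sq_power_words i by simp
  finally show ?thesis by blast
qed

lemma c_square: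
  "[(2, t), (2, t)] \<approx> (if t then [(0, True), (0, True), (1, True), (1, True)]
     else [(1, False), (1, False), (0, False), (0, False)])"
proof -
  let ?ab = "[(0, True), (0, True), (1, True), (1, True)] :: word"
  let ?ab' = "[(1, False), (1, False), (0, False), (0, False)] :: word"
  let ?c = "[(2, True), (2, True)] :: word" and ?c' = "[(2, False), (2, False)] :: word"
  have ab: "?ab \<approx> ?c" by (rule B2_eq_relation) (simp add: B2_torus_relations_def Let_def)
  \<comment> \<open>The relation is inverted by inserting \<open>a^2 b^2\<close> with its inverse
    behind \<open>c^-2\<close> and replacing \<open>a^2 b^2\<close> by \<open>c^2\<close>.\<close>
  have "?c' \<approx> ?c' @ ?ab @ ?ab'"
  proof -
    have "?ab @ ?ab' \<approx> [(0, True), (0, True), (0, False), (0, False)]"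
      using B2_eq_mid[OF square_cancel[of 1 True], of "[(0, True), (0, True)]" "[(0, False), (0, False)]"]
      by simp
    also have "\<dots> \<approx> []" using square_cancel[of 0 True] by simp
    finally have "[] \<approx> ?ab @ ?ab'" by (rule word_eq.sym)
    from B2_eq_mid[OF this, of ?c' "[]"] show ?thesis by simp
  qed
  also have "\<dots> \<approx> ?c' @ ?c @ ?ab'"
    using B2_eq_mid[OF ab, of ?c' ?ab'] by simp
  also have "\<dots> \<approx> ?ab'"
    using B2_eq_mid[OF square_cancel[of 2 False], of "[]" ?ab'] by simp
  finally show ?thesis using word_eq.sym[OF ab] by simp
qed

lemma square_sq_powers:
  assumes "i < 3"
  shows "\<exists>k' l'. [(i, t), (i, t)] @ sq_power 0 k @ sq_power 1 l \<approx> sq_power 0 k' @ sq_power 1 l'"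
proof (cases "i < 2")
  case True
  then show ?thesis by (rule ab_square_sq_powers)
next
  case False
  with assms have i: "i = 2" by simp
  \<comment> \<open>\<open>c_square\<close> gives \<open>a^2 b^2\<close> for a positive and
    \<open>b^-2 a^-2\<close> for a negative square. Here \<open>q\<close> is the right factor, which
    meets the central powers first.\<close>
  define p q :: nat where "p = (if t then 0 else 1)" and "q = (if t then 1 else 0)"
  have pq: "p < 2" "q < 2" by (auto simp: p_def q_def)
  obtain k1 l1 where 1: "[(q, t), (q, t)] @ sq_power 0 k @ sq_power 1 l \<approx> sq_power 0 k1 @ sq_power 1 l1"
    using ab_square_sq_powers[OF pq(2)] by blast
  obtain k2 l2 where 2: "[(p, t), (p, t)] @ sq_power 0 k1 @ sq_power 1 l1 \<approx> sq_power 0 k2 @ sq_power 1 l2"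
    using ab_square_sq_powers[OF pq(1)] by blast
  have "[(2, t), (2, t)] \<approx> [(p, t), (p, t), (q, t), (q, t)]"
    using c_square[of t] by (simp add: p_def q_def split: if_splits)
  from B2_eq_mid[OF this, of "[]" "sq_power 0 k @ sq_power 1 l"]
  have "[(2, t), (2, t)] @ sq_power 0 k @ sq_power 1 l
      \<approx> [(p, t), (p, t)] @ [(q, t), (q, t)] @ sq_power 0 k @ sq_power 1 l"
    using sq_power_words by simp
  also have "\<dots> \<approx> [(p, t), (p, t)] @ sq_power 0 k1 @ sq_power 1 l1"
    using B2_eq_mid[OF 1, of "[(p, t), (p, t)]" "[]"] pq by simp
  also note 2
  finally show ?thesis using i by blast
qed

section \<open>Normal forms and the word problem\<close>

text \<open>A section of the projection to the free product: every involution is lifted to the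
  positive generator.\<close>

definition pos :: "nat list \<Rightarrow> word" where
  "pos w = map (\<lambda>i. (i, True)) w"

lemma pos_simps [simp]: "pos [] = []" "pos (i # w) = (i, True) # pos w" "map fst (pos w) = w"
  by (simp_all add: pos_def comp_def)

lemma pos_words: "pos w \<in> words n \<longleftrightarrow> set w \<subseteq> {..<n}"
  by (induction w) auto

lemma map_fst_words: "w \<in> words n \<Longrightarrow> set (map fst w) \<subseteq> {..<n}"
  by (auto simp: words_def)

text \<open>The central powers move in front of \<open>p\<close>, absorb the square there, and move
  back.\<close>

lemma pull_square:
  assumes "p \<in> words 3" "i < 3"
  shows "\<exists>k' l'. [(i, t), (i, t)] @ p @ sq_power 0 k @ sq_power 1 l \<approx> p @ sq_power 0 k' @ sq_power 1 l'"
proof -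
  let ?z = "\<lambda>k l. sq_power 0 k @ sq_power 1 l"
  have c: "central (?z k l)" for k l by (intro central_append central_sq_power) auto
  then have w: "?z k l \<in> words 3" for k l by (simp add: central_def)
  have swap: "?z k l @ p \<approx> p @ ?z k l" for k l
    using c assms by (simp only: central_def)
  obtain k' l' where k': "[(i, t), (i, t)] @ ?z k l \<approx> ?z k' l'"
    using square_sq_powers[OF assms(2)] by blast
  have "[(i, t), (i, t)] @ p @ ?z k l \<approx> [(i, t), (i, t)] @ ?z k l @ p"
    using B2_eq_mid[OF word_eq.sym[OF swap[of k l]], of "[(i, t), (i, t)]" "[]"] assms by simp
  also have "\<dots> \<approx> ?z k' l' @ p"
    using B2_eq_mid[OF k', of "[]" p] assms by simp
  also have "\<dots> \<approx> p @ ?z k' l'" by (rule swap)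
  finally show ?thesis by blast
qed

lemma B2_normal_form:
  assumes "u \<in> words 3"
  shows "\<exists>k l. u \<approx> pos (red (map fst u)) @ sq_power 0 k @ sq_power 1 l"
  using assms
proof (induction u)
  case Nil
  then show ?case by (intro exI[of _ 0]) (simp add: sq_power_def word_eq.refl)
next
  case (Cons x u)
  obtain i t where x: "x = (i, t)" by force
  with Cons.prems have i: "i < 3" and u: "u \<in> words 3" by auto
  let ?z = "\<lambda>k l. sq_power 0 k @ sq_power 1 l"
  let ?r = "red (map fst u)"
  have z: "?z k l \<in> words 3" for k l using sq_power_words by simp
  obtain k l where "u \<approx> pos ?r @ ?z k l" using Cons u by blast
  from B2_eq_mid[OF this, of "[(i, t)]" "[]"] have IH: "x # u \<approx> (i, t) # pos ?r @ ?z k l"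
    using i x by simp
  have r: "pos ?r \<in> words 3"
    using map_fst_words[OF u] set_red[of "map fst u"] by (auto simp: pos_words)
  have red: "red (map fst (x # u)) = push i ?r" using x by simp
  show ?case
  proof (cases "\<exists>r'. ?r = i # r'")
    case True
    then obtain r' where r': "?r = i # r'" by blast
    have wr': "pos r' \<in> words 3" using r r' by simp
    \<comment> \<open>The new letter meets an equal positive letter: a positive one forms a square
      that goes into the exponents, a negative one cancels outright.\<close>
    have "\<exists>k' l'. (i, t) # pos ?r @ ?z k l \<approx> pos r' @ ?z k' l'"
    proof (cases t)
      case True
      then show ?thesis using pull_square[OF wr' i, of True k l] r' by simp
    next
      case False
      then show ?thesis
        using B2_eq_mid[OF letter_cancel[OF i, of False], of "[]" "pos r' @ ?z k l"] r' wr' z by auto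
    qed
    with IH red r' show ?thesis by (auto intro: word_eq.trans)
  next
    case False
    then have push: "push i ?r = i # ?r" by (cases ?r) auto
    have "\<exists>k' l'. (i, t) # pos ?r @ ?z k l \<approx> pos (i # ?r) @ ?z k' l'"
    proof (cases t)
      case True
      have "(i, True) # pos ?r @ ?z k l \<in> words 3" using r i z[of k l] by simp
      from word_eq.refl[OF this] show ?thesis
        by (simp only: True pos_simps append_Cons) blast
    next
      case False
      \<comment> \<open>Only positive letters may remain in front, so the inverse of a generator is
        written as its inverse square times the generator.\<close>
      have "(i, False) # pos ?r @ ?z k l \<approx> [(i, False), (i, False)] @ pos (i # ?r) @ ?z k l"
        using word_eq.sym[OF B2_eq_mid[OF letter_cancel[OF i, of False], of "[(i, False)]" "pos ?r @ ?z k l"]]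
          r i z[of k l] by simp
      moreover obtain k' l' where
        "[(i, False), (i, False)] @ pos (i # ?r) @ ?z k l \<approx> pos (i # ?r) @ ?z k' l'"
        using pull_square[of "pos (i # ?r)" i False k l] r i by auto
      ultimately have "(i, False) # pos ?r @ ?z k l \<approx> pos (i # ?r) @ ?z k' l'"
        by (rule word_eq.trans)
      with False show ?thesis by (simp only: simp_thms) blast
    qed
    with IH red push show ?thesis by (metis word_eq.trans)
  qed
qed

text \<open>Equal images in the free product give normal forms with the same positive part. The
  weights then fix the exponents: \<open>{0, 2}\<close> sees only the powers of \<open>a^2\<close>
  and \<open>{1, 2}\<close> only those of \<open>b^2\<close>.\<close>

lemma B2_eq_iff:
  assumes "u \<in> words 3" "v \<in> words 3"
  shows "u \<approx> v \<longleftrightarrow> weight {0, 2} u = weight {0, 2} v \<and> weight {1, 2} u = weight {1, 2} v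
    \<and> red (map fst u) = red (map fst v)" (is "_ \<longleftrightarrow> ?inv")
proof
  assume ?inv
  obtain k l where u: "u \<approx> pos (red (map fst u)) @ sq_power 0 k @ sq_power 1 l"
    using B2_normal_form assms by blast
  obtain k' l' where v: "v \<approx> pos (red (map fst v)) @ sq_power 0 k' @ sq_power 1 l'"
    using B2_normal_form assms by blast
  have "k = k'" "l = l'"
    using \<open>?inv\<close> B2_eq_invariants[OF u] B2_eq_invariants[OF v] by (auto simp: weight_sq_power)
  then show "u \<approx> v"
    using u v \<open>?inv\<close> word_eq.sym word_eq.trans by metis
qed (rule B2_eq_invariants)

section \<open>Conjugacy in terms of the invariants\<close>

lemma conjugate_B2_iff:
  assumes u: "u \<in> words 3" and v: "v \<in> words 3"
  shows "conjugate_in B2_torus (word_val B2_torus B2_torus_gens u) (word_val B2_torus B2_torus_gens v)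
    \<longleftrightarrow> weight {0, 2} u = weight {0, 2} v \<and> weight {1, 2} u = weight {1, 2} v
      \<and> conj_red 3 (map fst u) (map fst v)"
proof -
  interpret group B2_torus unfolding B2_torus_def by (rule group_presented_group)
  let ?c = "word_class 3 B2_torus_relations"
  have carrier: "carrier B2_torus = ?c ` words 3"
    by (simp add: B2_torus_def presented_group_def)
  have val: "word_val B2_torus B2_torus_gens w = ?c w" if "w \<in> words 3" for w
    using word_val_presented_group[OF that] by (simp add: B2_torus_def B2_torus_gens_def)
  have mult: "?c x \<otimes>\<^bsub>B2_torus\<^esub> ?c y = ?c (x @ y)" if "x \<in> words 3" "y \<in> words 3" for x y
    using presented_group_mult that by (simp add: B2_torus_def)
  \<comment> \<open>Moving \<open>g\<close> to the other side removes the inverse, so that only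
    concatenations of words have to be compared.\<close>
  have conj: "?c v = ?c g \<otimes>\<^bsub>B2_torus\<^esub> ?c u \<otimes>\<^bsub>B2_torus\<^esub> inv\<^bsub>B2_torus\<^esub> ?c g \<longleftrightarrow> v @ g \<approx> g @ u"
    if g: "g \<in> words 3" for g
  proof -
    have in_carrier: "?c u \<in> carrier B2_torus" "?c v \<in> carrier B2_torus" "?c g \<in> carrier B2_torus"
      using u v g by (auto simp: carrier)
    have "?c v = ?c g \<otimes>\<^bsub>B2_torus\<^esub> ?c u \<otimes>\<^bsub>B2_torus\<^esub> inv\<^bsub>B2_torus\<^esub> ?c g
        \<longleftrightarrow> ?c v \<otimes>\<^bsub>B2_torus\<^esub> ?c g = ?c g \<otimes>\<^bsub>B2_torus\<^esub> ?c u"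
      using inv_solve_right'[of "?c v" "?c g \<otimes>\<^bsub>B2_torus\<^esub> ?c u" "?c g"] in_carrier
      by (metis inv_closed inv_solve_right m_closed)
    also have "\<dots> \<longleftrightarrow> v @ g \<approx> g @ u"
      using u v g by (simp add: mult word_class_eq_iff)
    finally show ?thesis .
  qed
  have "conjugate_in B2_torus (word_val B2_torus B2_torus_gens u) (word_val B2_torus B2_torus_gens v)
      \<longleftrightarrow> (\<exists>g\<in>words 3. v @ g \<approx> g @ u)"
    unfolding conjugate_in_def carrier val[OF u] val[OF v] using conj by auto
  \<comment> \<open>The weight of \<open>g\<close> occurs once on each side and drops out; the
    conjugator matters only through its image in the free product.\<close>
  also have "\<dots> \<longleftrightarrow> weight {0, 2} u = weight {0, 2} v \<and> weight {1, 2} u = weight {1, 2} v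
      \<and> (\<exists>g\<in>words 3. red (map fst (v @ g)) = red (map fst (g @ u)))"
    using u v by (auto simp: B2_eq_iff)
  also have "(\<exists>g\<in>words 3. red (map fst (v @ g)) = red (map fst (g @ u)))
      \<longleftrightarrow> conj_red 3 (map fst u) (map fst v)"
  proof
    assume "\<exists>g\<in>words 3. red (map fst (v @ g)) = red (map fst (g @ u))"
    then obtain g where g: "g \<in> words 3" "red (map fst v @ map fst g) = red (map fst g @ map fst u)"
      by auto
    have "red (map fst g @ map fst u @ rev (map fst g)) = red (map fst v @ map fst g @ rev (map fst g))"
      using red_append_cong[OF g(2), of "[]" "rev (map fst g)"] by simp
    also have "\<dots> = red (map fst v)"
      using red_rev_cancel[of "map fst v" "rev (map fst g)" "[]"] by simp
    finally show "conj_red 3 (map fst u) (map fst v)"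
      unfolding conj_red_def using map_fst_words[OF g(1)] by blast
  next
    assume "conj_red 3 (map fst u) (map fst v)"
    then obtain g where g: "set g \<subseteq> {..<3}" "red (g @ map fst u @ rev g) = red (map fst v)"
      unfolding conj_red_def by blast
    have "red (map fst v @ g) = red (g @ map fst u @ rev g @ g)"
      using red_append_cong[OF g(2), of "[]" g] by simp
    also have "\<dots> = red (g @ map fst u)"
      using red_rev_cancel[of "g @ map fst u" g "[]"] by simp
    \<comment> \<open>A conjugator in the free product lifts to the braid group through
      \<open>pos\<close>.\<close>
    finally show "\<exists>g\<in>words 3. red (map fst (v @ g)) = red (map fst (g @ u))"
      using g(1) by (intro bexI[of _ "pos g"]) (simp_all add: pos_words)
  qed
  finally show ?thesis .
qed


section \<open>The decision procedure\<close>

lemma computable_push: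
  assumes "computable k f" "computable k (\<lambda>xs. list_encode (l xs))"
  shows "computable k (\<lambda>xs. list_encode (push (f xs) (l xs)))"
proof -
  have "computable k (\<lambda>xs. if l xs = [] then list_encode [f xs]
      else if (if l xs = [] then 0 else hd (l xs)) = f xs then list_encode (tl (l xs))
      else list_encode (f xs # l xs))"
    using assms by (intro computable_if computable_is_Nil computable_eq computable_hd computable_tl
        computable_Cons computable_const[of k "list_encode []"])
  then show ?thesis
  proof (rule computable_cong)
    fix xs
    show "(if l xs = [] then list_encode [f xs]
      else if (if l xs = [] then 0 else hd (l xs)) = f xs then list_encode (tl (l xs))
      else list_encode (f xs # l xs)) = list_encode (push (f xs) (l xs))"
      by (cases "l xs") (simp_all del: list_encode.simps)
  qed
qed

lemma computable_rot:
  assumes "computable k (\<lambda>xs. list_encode (l xs))"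
  shows "computable k (\<lambda>xs. list_encode (rot (l xs)))"
proof -
  have "computable k (\<lambda>xs. if l xs = [] then 0 else
      list_encode (rev (push (if l xs = [] then 0 else hd (l xs)) (rev (tl (l xs))))))"
    using assms by (intro computable_if computable_is_Nil computable_rev computable_push computable_hd
        computable_tl computable_const)
  then show ?thesis
  proof (rule computable_cong)
    fix xs
    show "(if l xs = [] then 0 else
        list_encode (rev (push (if l xs = [] then 0 else hd (l xs)) (rev (tl (l xs))))))
      = list_encode (rot (l xs))"
      by (cases "l xs") (simp_all add: rpush_def)
  qed
qed

definition code_red :: "nat \<Rightarrow> nat list" where
  "code_red n = foldr (\<lambda>x. push (fst (prod_decode x))) (list_decode n) []"

lemma code_red_word_code: "code_red (word_code w) = red (map fst w)"
  by (induction w) (auto simp: code_red_def word_code_def)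

lemma computable_code_red:
  assumes "computable k f"
  shows "computable k (\<lambda>xs. list_encode (code_red (f xs)))"
  unfolding code_red_def using assms
  by (intro computable_foldr computable_push computable_fst_prod_decode computable_list_decode
      computable_nth computable_const) auto

text \<open>Letters of one sign are counted at a time, so that natural numbers suffice; the weight
  is the difference of the counts for the two signs.\<close>

definition code_weight :: "nat \<Rightarrow> bool \<Rightarrow> nat \<Rightarrow> nat" where
  "code_weight i s n = count_list (list_decode n) (prod_encode (i, of_bool s))
     + count_list (list_decode n) (prod_encode (2, of_bool s))"

lemma computable_code_weight:
  "computable k f \<Longrightarrow> computable k (\<lambda>xs. code_weight i s (f xs))"
  unfolding code_weight_def
  by (intro computable_add computable_count_list computable_list_decode)

text \<open>For \<open>i = 2\<close> the two summands of \<open>code_weight\<close> would count the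
  same letters twice.\<close>

lemma weight_code_weight:
  assumes "i \<noteq> 2"
  shows "weight {i, 2} w = int (code_weight i True (word_code w)) - int (code_weight i False (word_code w))"
proof (induction w)
  case (Cons x w)
  obtain j s where "x = (j, s)" by force
  then show ?case
    using Cons assms by (cases s) (auto simp: code_weight_def word_code_def)
qed (simp add: code_weight_def word_code_def)

text \<open>Equality of weights is stated with the negative counts moved across, which avoids
  subtraction. In the search bounds 4 is one more than the number of generators, and a code bounds
  the length of its word.\<close>

definition B2_conj_codes :: "nat \<Rightarrow> nat \<Rightarrow> bool" where
  "B2_conj_codes m n \<longleftrightarrow>
     code_weight 0 True m + code_weight 0 False n = code_weight 0 True n + code_weight 0 False m
   \<and> code_weight 1 True m + code_weight 1 False n = code_weight 1 True n + code_weight 1 False m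
   \<and> (\<exists>i<4 ^ m. \<exists>j<4 ^ n. list_encode ((rot ^^ i) (code_red m)) = list_encode ((rot ^^ j) (code_red n)))"

lemma computable_B2_conj_codes: "computable2 (\<lambda>m n. of_bool (B2_conj_codes m n))"
  unfolding B2_conj_codes_def
  by (intro computable_conj computable_bex computable_eq computable_add computable_code_weight
      computable_power computable_funpow_list computable_rot computable_code_red computable_list_decode)
     (auto intro: computable_nth computable_nth_tl)

lemma B2_conj_codes_iff:
  assumes "u \<in> words 3" "v \<in> words 3"
  shows "B2_conj_codes (word_code u) (word_code v) \<longleftrightarrow>
    conjugate_in B2_torus (word_val B2_torus B2_torus_gens u) (word_val B2_torus B2_torus_gens v)"
proof -
  have len: "length (red (map fst w)) \<le> word_code w" for w
    using length_red[of "map fst w"] length_le_list_encode[of "map (\<lambda>(i, s). prod_encode (i, of_bool s)) w"]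
    by (simp add: word_code_def)
  have set: "set (red (map fst w)) \<subseteq> {..<3}" if "w \<in> words 3" for w
    using set_red map_fst_words[OF that] by blast
  have "conj_red 3 (map fst u) (map fst v) \<longleftrightarrow>
    (\<exists>i<4 ^ word_code u. \<exists>j<4 ^ word_code v. (rot ^^ i) (red (map fst u)) = (rot ^^ j) (red (map fst v)))"
    using conj_red_iff_rot_equiv[OF map_fst_words map_fst_words, OF assms]
      rot_equiv_iff_bounded[OF set set len len distinct_adj_red distinct_adj_red, OF assms]
    by simp
  then show ?thesis
    using assms
    by (auto simp: B2_conj_codes_def conjugate_B2_iff weight_code_weight code_red_word_code list_encode_eq)
qed

theorem corollary4p9:
  shows "conjugacy_problem_solvable B2_torus B2_torus_gens"
proof -
  obtain p where p: "\<And>xs. length xs = 2 \<Longrightarrow> computes p xs (of_bool (B2_conj_codes (xs ! 0) (xs ! 1)))"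
    using computable_B2_conj_codes unfolding computable_def by blast
  have "length B2_torus_gens = 3"
    by (simp add: B2_torus_gens_def presentation_gens_def)
  moreover have "computes p [word_code u, word_code v]
      (if conjugate_in B2_torus (word_val B2_torus B2_torus_gens u) (word_val B2_torus B2_torus_gens v)
       then 1 else 0)" if "u \<in> words 3" "v \<in> words 3" for u v
    using p[of "[word_code u, word_code v]"] B2_conj_codes_iff[OF that] by (simp add: of_bool_def)
  ultimately show ?thesis unfolding conjugacy_problem_solvable_def by (intro exI[of _ p]) simp
qed

end
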